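(* Let $\mathcal C=(V,E)$ be a clutter with $n=|V|$ vertices and $m=|E|$ edges. Then $\mathcal C$ packs for every $\mathbf c\in\mathbb Z^n_{\geq 0}$ with $\mathbf c\leq \left\lceil\frac m2\right\rceil\mathbf 1_n$ (componentwise) if and only if $\mathcal C$ satisfies the Max-Flow-Min-Cut property.
   Context: A clutter $\mathcal C=(V,E)$ is a collection $E$ of subsets of a finite set $V=\{v_1,\ldots,v_n\}$ such that any two distinct elements of $E$ are incomparable with respect to inclusion. Let $M=M(\mathcal C)$ be the $n\times m$ matrix with entries $0$ or $1$ whose columns are the incidence vectors of the sets in $E$. Let $\mathbf 1_r=(1,\ldots,1)\in\mathbb Z^r$. For $\mathbf c\in\mathbb Z^n_{\geq 0}$, strong duality of linear programming gives $$\min\{\mathbf c\cdot\mathbf x\mid \mathbf x\in\mathbb R^n_{\geq 0},\ M^T\mathbf x\geq \mathbf 1_m\}=\max\{\mathbf 1_m\cdot\mathbf y\mid \mathbf y\in\mathbb R^m_{\geq 0},\ M\mathbf y\leq\mathbf c\}.$$ The clutter $\mathcal C$ packs for $\mathbf c$ if this equality holds with integer vectors, i.e. $$\min\{\mathbf c\cdot\mathbf x\mid \mathbf x\in\mathbb Z^n_{\geq 0},\ M^T\mathbf x\geq \mathbf 1_m\}=\max\{\mathbf 1_m\cdot\mathbf y\mid \mathbf y\in\mathbb Z^m_{\geq 0},\ M\mathbf y\leq\mathbf c\}.$$ The clutter $\mathcal C$ satisfies the Max-Flow-Min-Cut (MFMC) property if it packs for every $\mathbf c\in\mathbb Z^n_{\geq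 0}$. *)

theory Defs
  imports Complex_Main
begin

definition clutter :: "'a set \<Rightarrow> 'a set set \<Rightarrow> bool" where
  "clutter V E \<longleftrightarrow> finite V \<and> (\<forall>e\<in>E. e \<subseteq> V) \<and> (\<forall>e\<in>E. \<forall>f\<in>E. e \<noteq> f \<longrightarrow> \<not> e \<subseteq> f)"

text \<open>
  The incidence matrix \<open>M(C)\<close>. Rows and columns are indexed by the vertices and the edges
  themselves rather than by \<open>{1..n}\<close> and \<open>{1..m}\<close>; correspondingly, vectors in
  \<open>\<int>\<^sup>n\<close> and \<open>\<int>\<^sup>m\<close> with nonnegative entries are functions into \<^typ>\<open>nat\<close>, of which only
  the values on \<open>V\<close> and \<open>E\<close> respectively matter.
\<close>

definition incidence :: "'a \<Rightarrow> 'a set \<Rightarrow> nat" where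
  "incidence v e = (if v \<in> e then 1 else 0)"

text \<open>The values \<open>c \<cdot> x\<close> with \<open>x \<ge> 0\<close> integral and \<open>M\<^sup>T x \<ge> 1\<close>.\<close>

definition cover_values :: "'a set \<Rightarrow> 'a set set \<Rightarrow> ('a \<Rightarrow> nat) \<Rightarrow> nat set" where
  "cover_values V E c =
     {(\<Sum>v\<in>V. c v * x v) | x. \<forall>e\<in>E. (\<Sum>v\<in>V. incidence v e * x v) \<ge> 1}"

text \<open>The values \<open>1 \<cdot> y\<close> with \<open>y \<ge> 0\<close> integral and \<open>M y \<le> c\<close>.\<close>

definition packing_values :: "'a set \<Rightarrow> 'a set set \<Rightarrow> ('a \<Rightarrow> nat) \<Rightarrow> nat set" where
  "packing_values V E c =
     {(\<Sum>e\<in>E. y e) | y. \<forall>v\<in>V. (\<Sum>e\<in>E. incidence v e * y e) \<le> c v}"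

text \<open>
  The minimum and the maximum are both attained and are equal. For \<open>E = {{}}\<close> neither
  exists (no cover is feasible and the packings are unbounded), so this clutter packs for no \<open>c\<close>.
\<close>

definition packs :: "'a set \<Rightarrow> 'a set set \<Rightarrow> ('a \<Rightarrow> nat) \<Rightarrow> bool" where
  "packs V E c \<longleftrightarrow>
     (\<exists>k. (k \<in> cover_values V E c \<and> (\<forall>s\<in>cover_values V E c. k \<le> s)) \<and>
          (k \<in> packing_values V E c \<and> (\<forall>t\<in>packing_values V E c. t \<le> k)))"

definition MFMC :: "'a set \<Rightarrow> 'a set set \<Rightarrow> bool" where
  "MFMC V E \<longleftrightarrow> (\<forall>c. packs V E c)"

end

theory Submission
  imports Defs
begin

text \<open>
  Write \<open>\<tau>(c)\<close> for the minimum weight of a cover. The key is a halving step: if \<open>2c\<close> admits a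
  packing \<open>y\<close> of size at least \<open>2k - 1\<close>, then \<open>c\<close> admits one of size \<open>k\<close>. Indeed
  \<open>y mod 2\<close> has entries at most \<open>1\<close>, so the part of \<open>c\<close> needed for \<open>(y mod 2)/2\<close> is at most
  \<open>\<lceil>m/2\<rceil>\<close>; there the hypothesis rounds this half-integral packing up to an integral one, which is
  added to \<open>y div 2\<close>. Iterating, it suffices that some \<open>2\<^sup>r c\<close> has a packing of size
  greater than \<open>2\<^sup>r (k - 1)\<close>, that is, that \<open>c\<close> has a fractional packing of size greater than
  \<open>k - 1\<close>. If \<open>\<tau>(c) \<ge> k > 0\<close>, choose an edge \<open>e\<close> in the support of \<open>c\<close>. By induction on \<open>k\<close>,
  for each \<open>v \<in> e\<close> there is a packing of size \<open>k - 1\<close> for \<open>c\<close> decreased by one at \<open>v\<close>; their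
  average leaves room for \<open>1/|e|\<close> copies of \<open>e\<close>.
\<close>

section \<open>Vertex covers and weak duality\<close>

definition cover :: "'a set \<Rightarrow> 'a set set \<Rightarrow> 'a set \<Rightarrow> bool" where
  "cover V E B \<longleftrightarrow> B \<subseteq> V \<and> (\<forall>e\<in>E. B \<inter> e \<noteq> {})"

definition packing :: "'a set \<Rightarrow> 'a set set \<Rightarrow> ('a \<Rightarrow> nat) \<Rightarrow> ('a set \<Rightarrow> nat) \<Rightarrow> bool" where
  "packing V E c y \<longleftrightarrow> (\<forall>v\<in>V. (\<Sum>e | e \<in> E \<and> v \<in> e. y e) \<le> c v)"

text \<open>Every edge meets \<open>B\<close>, so the double sum counts it at least once. Bounding
  by vertex loads instead of capacities lets \<open>halve_packing\<close> use this for a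
  half-integral packing.\<close>

lemma sum_le_sum_over_cover:
  fixes y :: "'a set \<Rightarrow> nat"
  assumes "finite V" "finite E" "cover V E B"
  shows "(\<Sum>e\<in>E. y e) \<le> (\<Sum>v\<in>B. \<Sum>e | e \<in> E \<and> v \<in> e. y e)"
proof -
  have fB: "finite B"
    using assms by (auto simp: cover_def intro: finite_subset)
  have "y e \<le> (\<Sum>v | v \<in> B \<and> v \<in> e. y e)" if "e \<in> E" for e
  proof -
    obtain v where "v \<in> B \<inter> e"
      using \<open>e \<in> E\<close> assms(3) by (auto simp: cover_def)
    then have "(\<Sum>w\<in>{v}. y e) \<le> (\<Sum>w | w \<in> B \<and> w \<in> e. y e)"
      using fB by (intro sum_mono2) auto
    then show ?thesis by simp
  qed
  then have "(\<Sum>e\<in>E. y e) \<le> (\<Sum>e\<in>E. \<Sum>v | v \<in> B \<and> v \<in> e. y e)"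
    by (rule sum_mono)
  also have "\<dots> = (\<Sum>v\<in>B. \<Sum>e | e \<in> E \<and> v \<in> e. y e)"
    using assms(2) fB by (rule sum.swap_restrict)
  finally show ?thesis .
qed

lemma packing_le_cover:
  assumes "finite V" "finite E" "cover V E B" "packing V E c y"
  shows "sum y E \<le> sum c B"
proof -
  have "sum y E \<le> (\<Sum>v\<in>B. \<Sum>e | e \<in> E \<and> v \<in> e. y e)"
    using assms(1-3) by (rule sum_le_sum_over_cover)
  also have "\<dots> \<le> sum c B"
    using assms(3,4) by (intro sum_mono) (auto simp: packing_def cover_def)
  finally show ?thesis .
qed

section \<open>Arithmetic of packings\<close>

lemma packing_add:
  assumes "packing V E c y" "packing V E d z"
  shows "packing V E (\<lambda>v. c v + d v) (\<lambda>e. y e + z e)"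
  using assms by (auto simp: packing_def sum.distrib intro: add_mono)

lemma packing_sum:
  assumes "\<And>i. i \<in> I \<Longrightarrow> packing V E (c i) (y i)"
  shows "packing V E (\<lambda>v. \<Sum>i\<in>I. c i v) (\<lambda>e. \<Sum>i\<in>I. y i e)"
  unfolding packing_def
proof
  fix v assume "v \<in> V"
  have "(\<Sum>e | e \<in> E \<and> v \<in> e. \<Sum>i\<in>I. y i e) = (\<Sum>i\<in>I. \<Sum>e | e \<in> E \<and> v \<in> e. y i e)"
    by (rule sum.swap)
  also have "\<dots> \<le> (\<Sum>i\<in>I. c i v)"
    using assms \<open>v \<in> V\<close> by (intro sum_mono) (auto simp: packing_def)
  finally show "(\<Sum>e | e \<in> E \<and> v \<in> e. \<Sum>i\<in>I. y i e) \<le> (\<Sum>i\<in>I. c i v)" .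
qed

lemma packing_single:
  assumes "finite E"
  shows "packing V E (\<lambda>v. incidence v e) (\<lambda>f. if f = e then 1 else 0)"
  using assms by (auto simp: packing_def incidence_def sum.delta)

text \<open>Here \<open>y / s\<close> is a fractional packing for \<open>c\<close>; rounding its
  \<open>N\<close>-fold multiple down keeps it feasible for \<open>N * c\<close>.\<close>

lemma packing_rescale:
  assumes "packing V E (\<lambda>v. s * c v) y" "s > 0"
  shows "packing V E (\<lambda>v. N * c v) (\<lambda>e. N * y e div s)"
  unfolding packing_def
proof
  fix v assume "v \<in> V"
  have "s * (\<Sum>e | e \<in> E \<and> v \<in> e. N * y e div s) \<le> (\<Sum>e | e \<in> E \<and> v \<in> e. N * y e)"
    unfolding sum_distrib_left by (intro sum_mono) simp
  also have "\<dots> = N * (\<Sum>e | e \<in> E \<and> v \<in> e. y e)"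
    by (simp add: sum_distrib_left)
  also have "\<dots> \<le> N * (s * c v)"
    using assms(1) \<open>v \<in> V\<close> by (intro mult_left_mono) (auto simp: packing_def)
  finally have "s * (\<Sum>e | e \<in> E \<and> v \<in> e. N * y e div s) \<le> s * (N * c v)"
    by (simp add: ac_simps)
  then show "(\<Sum>e | e \<in> E \<and> v \<in> e. N * y e div s) \<le> N * c v"
    using \<open>s > 0\<close> by simp
qed

text \<open>Rounding down loses less than one per edge, hence at most \<open>card E\<close> in
  total.\<close>

lemma sum_rescale_ge:
  fixes y :: "'b \<Rightarrow> nat"
  assumes "s > 0"
  shows "N * sum y E \<le> s * ((\<Sum>e\<in>E. N * y e div s) + card E)"
proof -
  have "N * y e \<le> s * (N * y e div s + 1)" for e
    using assms dividend_less_times_div[of s "N * y e"] by simp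
  then have "(\<Sum>e\<in>E. N * y e) \<le> (\<Sum>e\<in>E. s * (N * y e div s + 1))"
    by (rule sum_mono)
  also have "\<dots> = s * (\<Sum>e\<in>E. N * y e div s + 1)"
    by (simp only: sum_distrib_left)
  also have "\<dots> = s * ((\<Sum>e\<in>E. N * y e div s) + card E)"
    by (simp only: sum.distrib) simp
  finally show ?thesis by (simp add: sum_distrib_left)
qed

section \<open>Halving, and the induction on the size of the packing\<close>

lemma halve_packing:
  assumes fin: "finite V" "finite E"
    and hyp: "\<And>c k. \<lbrakk>\<And>v. c v \<le> (card E + 1) div 2; \<And>B. cover V E B \<Longrightarrow> k \<le> sum c B\<rbrakk>
      \<Longrightarrow> \<exists>y. packing V E c y \<and> k \<le> sum y E"
    and y: "packing V E (\<lambda>v. 2 * c v) y"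
  shows "\<exists>y'. packing V E c y' \<and> sum y E \<le> 2 * sum y' E"
proof -
  define q where "q = (\<lambda>e. y e div 2)"
  define z where "z = (\<lambda>e. y e mod 2)"
  define Q where "Q = (\<lambda>v. \<Sum>e | e \<in> E \<and> v \<in> e. q e)"
  \<comment> \<open>The capacity left by \<open>q\<close>, capped so that \<open>hyp\<close>
    applies. The cap still leaves room for \<open>z / 2\<close>: the load of \<open>z\<close> at a
    vertex is at most \<open>card E\<close>, hence at most twice the cap.\<close>
  define c' where "c' = (\<lambda>v. min (c v - Q v) ((card E + 1) div 2))"
  have split: "sum y A = 2 * sum q A + sum z A" for A
    by (simp add: q_def z_def sum_distrib_left sum.distrib[symmetric])
  have Q: "2 * Q v + (\<Sum>e | e \<in> E \<and> v \<in> e. z e) \<le> 2 * c v" if "v \<in> V" for v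
    using y that split[of "{e \<in> E. v \<in> e}"] by (auto simp: packing_def Q_def)
  have c': "(\<Sum>e | e \<in> E \<and> v \<in> e. z e) \<le> 2 * c' v" if "v \<in> V" for v
  proof -
    have "(\<Sum>e | e \<in> E \<and> v \<in> e. z e) \<le> (\<Sum>e | e \<in> E \<and> v \<in> e. 1)"
      by (intro sum_mono) (simp add: z_def)
    also have "\<dots> \<le> card E"
      using fin(2) by (simp add: card_mono)
    finally have "(\<Sum>e | e \<in> E \<and> v \<in> e. z e) \<le> 2 * ((card E + 1) div 2)"
      by linarith
    moreover have "(\<Sum>e | e \<in> E \<and> v \<in> e. z e) \<le> 2 * (c v - Q v)"
      using Q[OF that] by simp
    ultimately show ?thesis
      by (simp add: c'_def min_def)
  qed
  \<comment> \<open>Since \<open>z / 2\<close> fits into \<open>c'\<close>, every cover weighs at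
    least half of \<open>sum z E\<close>; cover weights are integers, so this bound rounds
    up.\<close>
  have "\<exists>w. packing V E c' w \<and> (sum z E + 1) div 2 \<le> sum w E"
  proof (rule hyp)
    show "c' v \<le> (card E + 1) div 2" for v
      by (simp add: c'_def)
  next
    fix B assume B: "cover V E B"
    have "sum z E \<le> (\<Sum>v\<in>B. \<Sum>e | e \<in> E \<and> v \<in> e. z e)"
      using fin B by (rule sum_le_sum_over_cover)
    also have "\<dots> \<le> (\<Sum>v\<in>B. 2 * c' v)"
      using B c' by (intro sum_mono) (auto simp: cover_def)
    finally show "(sum z E + 1) div 2 \<le> sum c' B"
      by (simp add: sum_distrib_left[symmetric])
  qed
  then obtain w where w: "packing V E c' w" "(sum z E + 1) div 2 \<le> sum w E"
    by blast
  have "packing V E c (\<lambda>e. q e + w e)"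
    unfolding packing_def
  proof
    fix v assume "v \<in> V"
    then have "(\<Sum>e | e \<in> E \<and> v \<in> e. w e) \<le> c v - Q v"
      using w(1) by (auto simp: packing_def c'_def)
    then show "(\<Sum>e | e \<in> E \<and> v \<in> e. q e + w e) \<le> c v"
      using Q[OF \<open>v \<in> V\<close>] by (simp add: sum.distrib Q_def)
  qed
  moreover have "sum y E \<le> 2 * (\<Sum>e\<in>E. q e + w e)"
    using w(2) split[of E] by (simp add: sum.distrib)
  ultimately show ?thesis
    by blast
qed

text \<open>No loss accumulates: \<open>2 ^ Suc r * k < sum y E\<close> and
  \<open>sum y E \<le> 2 * sum y' E\<close> give \<open>2 ^ r * k < sum y' E\<close>, so the strict
  bound survives each halving.\<close>

lemma halve_packing_iterated:
  assumes fin: "finite V" "finite E"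
    and hyp: "\<And>c k. \<lbrakk>\<And>v. c v \<le> (card E + 1) div 2; \<And>B. cover V E B \<Longrightarrow> k \<le> sum c B\<rbrakk>
      \<Longrightarrow> \<exists>y. packing V E c y \<and> k \<le> sum y E"
    and "packing V E (\<lambda>v. 2 ^ r * c v) y" "2 ^ r * k < sum y E"
  shows "\<exists>y'. packing V E c y' \<and> k < sum y' E"
  using assms(4,5)
proof (induction r arbitrary: y)
  case 0
  then show ?case by auto
next
  case (Suc r)
  from Suc.prems(1) have "packing V E (\<lambda>v. 2 * (2 ^ r * c v)) y"
    by (simp add: mult.assoc)
  from halve_packing[OF fin hyp this] obtain y'
    where "packing V E (\<lambda>v. 2 ^ r * c v) y'" "sum y E \<le> 2 * sum y' E"
    by blast
  with Suc.prems(2) show ?case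
    by (intro Suc.IH[of y']) auto
qed

lemma packing_of_cover_bound:
  assumes fin: "finite V" "finite E" and sub: "E \<subseteq> Pow V" and ne: "{} \<notin> E"
    and hyp: "\<And>c k. \<lbrakk>\<And>v. c v \<le> (card E + 1) div 2; \<And>B. cover V E B \<Longrightarrow> k \<le> sum c B\<rbrakk>
      \<Longrightarrow> \<exists>y. packing V E c y \<and> k \<le> sum y E"
  shows "(\<And>B. cover V E B \<Longrightarrow> k \<le> sum c B) \<Longrightarrow> \<exists>y. packing V E c y \<and> k \<le> sum y E"
proof (induction k arbitrary: c)
  case 0
  then show ?case
    by (intro exI[of _ "\<lambda>_. 0"]) (simp add: packing_def)
next
  case (Suc k)
  \<comment> \<open>The zero set of \<open>c\<close> has weight 0, so it is no cover; an edge that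
    it misses lies in the support.\<close>
  have "\<not> cover V E {v \<in> V. c v = 0}"
    using Suc.prems[of "{v \<in> V. c v = 0}"] by auto
  then obtain e where e: "e \<in> E" "\<And>v. v \<in> e \<Longrightarrow> c v > 0"
    using sub by (fastforce simp: cover_def)
  have fe: "finite e"
    using e(1) sub fin(1) finite_subset by blast
  define s where "s = card e"
  have s: "s > 0"
    using e(1) ne fe by (auto simp: s_def card_gt_0_iff)
  \<comment> \<open>Lowering \<open>c\<close> at one vertex lowers the weight of a cover by at most
    one.\<close>
  have "\<exists>y. packing V E (c(v := c v - 1)) y \<and> k \<le> sum y E" if v: "v \<in> e" for v
  proof (rule Suc.IH)
    fix B assume B: "cover V E B"
    have fB: "finite B"
      using B fin(1) by (auto simp: cover_def intro: finite_subset)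
    have "sum c B \<le> (\<Sum>w\<in>B. (c(v := c v - 1)) w + (if w = v then 1 else 0))"
      by (intro sum_mono) auto
    also have "\<dots> \<le> sum (c(v := c v - 1)) B + 1"
      using fB by (simp only: sum.distrib) (simp add: sum.delta)
    finally show "k \<le> sum (c(v := c v - 1)) B"
      using Suc.prems[OF B] by linarith
  qed
  then obtain Y where Y: "\<And>v. v \<in> e \<Longrightarrow> packing V E (c(v := c v - 1)) (Y v)"
      "\<And>v. v \<in> e \<Longrightarrow> k \<le> sum (Y v) E"
    by metis
  define y where "y = (\<lambda>f. (\<Sum>v\<in>e. Y v f) + (if f = e then 1 else 0))"
  have "packing V E (\<lambda>w. (\<Sum>v\<in>e. (c(v := c v - 1)) w) + incidence w e) y"
    unfolding y_def by (rule packing_add[OF packing_sum[OF Y(1)] packing_single[OF fin(2)]])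
  \<comment> \<open>For \<open>w\<close> in \<open>e\<close>, exactly one summand is lowered at
    \<open>w\<close>, and the extra copy of \<open>e\<close> uses the freed unit. The subtraction is
    not truncated, since \<open>c\<close> is positive on \<open>e\<close>.\<close>
  moreover have "(\<Sum>v\<in>e. (c(v := c v - 1)) w) + incidence w e = s * c w" for w
  proof -
    have "(\<Sum>v\<in>e. (c(v := c v - 1)) w) + incidence w e
        = (\<Sum>v\<in>e. (c(v := c v - 1)) w + (if v = w then 1 else 0))"
      using fe by (simp only: sum.distrib) (simp add: sum.delta incidence_def)
    also have "\<dots> = (\<Sum>v\<in>e. c w)"
      using e(2) by (intro sum.cong refl) auto
    finally show ?thesis by (simp add: s_def)
  qed
  ultimately have y: "packing V E (\<lambda>v. s * c v) y"
    by simp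
  have "s * k + 1 \<le> (\<Sum>v\<in>e. sum (Y v) E) + 1"
    using sum_mono[of e "\<lambda>_. k", OF Y(2)] by (simp add: s_def)
  also have "\<dots> = sum y E"
    using fin(2) e(1) sum.swap[of "\<lambda>v f. Y v f" E e] by (simp add: y_def sum.distrib sum.delta)
  finally have size: "s * k + 1 \<le> sum y E" .
  \<comment> \<open>As \<open>s\<close> need not be a power of two, \<open>y / s\<close> is rounded
    at scale \<open>2 ^ r\<close>. Its size exceeds \<open>k\<close> by at least
    \<open>1 / s\<close>; at that scale the excess is at least \<open>2 ^ r / s\<close>, more than
    the rounding loss \<open>card E\<close>.\<close>
  obtain r :: nat where r: "s * card E < 2 ^ r"
    using less_exp by blast
  let ?y = "\<lambda>f. 2 ^ r * y f div s"
  have "s * (2 ^ r * k + card E) < 2 ^ r * (s * k + 1)"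
    using r by (simp add: algebra_simps)
  also have "\<dots> \<le> 2 ^ r * sum y E"
    using size by (intro mult_left_mono) auto
  also have "\<dots> \<le> s * (sum ?y E + card E)"
    using s by (rule sum_rescale_ge)
  finally have "2 ^ r * k < sum ?y E"
    using s by simp
  moreover have "packing V E (\<lambda>v. 2 ^ r * c v) ?y"
    using y s by (rule packing_rescale)
  ultimately have "\<exists>y'. packing V E c y' \<and> k < sum y' E"
    using halve_packing_iterated[OF fin hyp] by blast
  then show ?case
    by (auto simp: Suc_le_eq)
qed

section \<open>Back to the matrix formulation\<close>

lemma sum_incidence_packing:
  assumes "finite E"
  shows "(\<Sum>e\<in>E. incidence v e * y e) = (\<Sum>e | e \<in> E \<and> v \<in> e. y e)"
  using assms by (simp add: incidence_def sum.inter_filter if_distrib[of "\<lambda>x. x * _"] cong: if_cong)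

lemma packing_values_iff:
  assumes "finite E"
  shows "t \<in> packing_values V E c \<longleftrightarrow> (\<exists>y. packing V E c y \<and> t = sum y E)"
  using assms by (auto simp: packing_values_def packing_def sum_incidence_packing)

lemma cover_value_of_cover:
  assumes "finite V" "cover V E B"
  shows "sum c B \<in> cover_values V E c"
proof -
  let ?x = "\<lambda>v. if v \<in> B then 1 else 0 :: nat"
  have "1 \<le> (\<Sum>v\<in>V. incidence v e * ?x v)" if "e \<in> E" for e
  proof -
    have "B \<subseteq> V" "B \<inter> e \<noteq> {}"
      using assms(2) that by (auto simp: cover_def)
    then obtain v where "v \<in> B" "v \<in> e" "v \<in> V"
      by blast
    then show ?thesis
      using member_le_sum[of v V "\<lambda>v. incidence v e * ?x v"] assms(1) by (simp add: incidence_def)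
  qed
  moreover have "(\<Sum>v\<in>V. c v * ?x v) = sum c B"
  proof -
    have "(\<Sum>v\<in>V. c v * ?x v) = (\<Sum>v\<in>V. if v \<in> B then c v else 0)"
      by (intro sum.cong) auto
    also have "\<dots> = sum c (V \<inter> B)"
      using assms(1) by (simp add: sum.inter_restrict)
    also have "V \<inter> B = B"
      using assms(2) by (auto simp: cover_def)
    finally show ?thesis .
  qed
  ultimately show ?thesis
    unfolding cover_values_def by (intro CollectI exI[of _ ?x]) simp
qed

text \<open>Entries on the support are at least one and weights are nonnegative, so passing from an
  integral vector to its support cannot increase the value.\<close>

lemma cover_le_cover_value:
  assumes "finite V" "s \<in> cover_values V E c"
  obtains B where "cover V E B" "sum c B \<le> s"
proof -
  obtain x where x: "s = (\<Sum>v\<in>V. c v * x v)" "\<And>e. e \<in> E \<Longrightarrow> (\<Sum>v\<in>V. incidence v e * x v) \<ge> 1"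
    using assms(2) by (auto simp: cover_values_def)
  let ?B = "{v \<in> V. x v > 0}"
  have "?B \<inter> e \<noteq> {}" if "e \<in> E" for e
  proof
    assume "?B \<inter> e = {}"
    then have "(\<Sum>v\<in>V. incidence v e * x v) = 0"
      by (intro sum.neutral) (auto simp: incidence_def)
    with x(2)[OF that] show False by simp
  qed
  then have "cover V E ?B"
    by (auto simp: cover_def)
  moreover have "sum c ?B \<le> (\<Sum>v\<in>?B. c v * x v)"
    by (intro sum_mono) auto
  moreover have "\<dots> \<le> s"
    unfolding x(1) using assms(1) by (intro sum_mono2) auto
  ultimately show ?thesis
    using that by (meson le_trans)
qed

text \<open>Weak duality gives one inequality; what remains is a packing that reaches each lower
  bound on the covers. Quantifying over \<open>k\<close> avoids naming the minimum and suits the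
  induction.\<close>

lemma packs_iff:
  assumes "finite V" "finite E" "E \<subseteq> Pow V" "{} \<notin> E"
  shows "packs V E c \<longleftrightarrow>
    (\<forall>k. (\<forall>B. cover V E B \<longrightarrow> k \<le> sum c B) \<longrightarrow> (\<exists>y. packing V E c y \<and> k \<le> sum y E))"
    (is "_ \<longleftrightarrow> ?R")
proof
  assume "packs V E c"
  then obtain K where K: "K \<in> cover_values V E c" "K \<in> packing_values V E c"
    by (auto simp: packs_def)
  from K(2) obtain y where y: "packing V E c y" "K = sum y E"
    using assms(2) by (auto simp: packing_values_iff)
  from K(1) obtain B where "cover V E B" "sum c B \<le> K"
    using assms(1) cover_le_cover_value by blast
  with y show ?R
    by (meson le_trans)
next
  assume R: ?R
  have weak: "t \<le> s" if "t \<in> packing_values V E c" "s \<in> cover_values V E c" for s t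
  proof -
    from that(2) obtain B where "cover V E B" "sum c B \<le> s"
      using assms(1) cover_le_cover_value by blast
    moreover from that(1) obtain y where "packing V E c y" "t = sum y E"
      using assms(2) by (auto simp: packing_values_iff)
    ultimately show ?thesis
      using packing_le_cover[OF assms(1,2)] by (meson le_trans)
  qed
  define K where "K = (LEAST s. s \<in> cover_values V E c)"
  \<comment> \<open>No edge is empty, so \<open>V\<close> is a cover and the \<open>LEAST\<close> is
    attained.\<close>
  have "cover V E V"
    using assms(3,4) by (auto simp: cover_def Int_absorb1 subset_iff)
  then have "sum c V \<in> cover_values V E c"
    using assms(1) cover_value_of_cover by blast
  then have K: "K \<in> cover_values V E c"
    unfolding K_def by (rule LeastI)
  have least: "K \<le> s" if "s \<in> cover_values V E c" for s
    unfolding K_def using that by (rule Least_le)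
  then obtain y where y: "packing V E c y" "K \<le> sum y E"
    using R cover_value_of_cover[OF assms(1), of E _ c] by meson
  then have "sum y E \<in> packing_values V E c"
    using assms(2) by (auto simp: packing_values_iff)
  with weak[OF _ K] y(2) have "K \<in> packing_values V E c"
    using le_antisym by metis
  then show "packs V E c"
    unfolding packs_def using K least weak by blast
qed

text \<open>The constraint of the empty edge reads \<open>0 \<ge> 1\<close>, so there is no cover
  value to attain.\<close>

lemma not_packs_empty_edge:
  assumes "{} \<in> E"
  shows "\<not> packs V E c"
  using assms by (force simp: packs_def cover_values_def incidence_def)

theorem theorem5p2:
  fixes V :: "'a set" and E :: "'a set set"
  assumes "clutter V E"
  shows "(\<forall>c :: 'a \<Rightarrow> nat. (\<forall>v\<in>V. int (c v) \<le> \<lceil>real (card E) / 2\<rceil>) \<longrightarrow> packs V E c)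
           \<longleftrightarrow> MFMC V E"
proof
  assume small: "\<forall>c :: 'a \<Rightarrow> nat. (\<forall>v\<in>V. int (c v) \<le> \<lceil>real (card E) / 2\<rceil>) \<longrightarrow> packs V E c"
  have fin: "finite V" "finite E" and sub: "E \<subseteq> Pow V"
    using assms by (auto simp: clutter_def intro: finite_subset[of E "Pow V"])
  \<comment> \<open>The zero capacity meets the bound for any \<open>card E\<close>, and packing for
    it already excludes an empty edge.\<close>
  have "packs V E (\<lambda>_. 0)"
    using small by simp
  then have ne: "{} \<notin> E"
    using not_packs_empty_edge by blast
  have half: "int ((card E + 1) div 2) \<le> \<lceil>real (card E) / 2\<rceil>"
    by linarith
  have bounded: "\<exists>y. packing V E c y \<and> k \<le> sum y E"
    if "\<And>v. c v \<le> (card E + 1) div 2" "\<And>B. cover V E B \<Longrightarrow> k \<le> sum c B" for c k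
  proof -
    have "int (c v) \<le> \<lceil>real (card E) / 2\<rceil>" for v
      using that(1)[of v] half by linarith
    then have "packs V E c"
      using small by blast
    then show ?thesis
      using packs_iff[OF fin sub ne] that(2) by blast
  qed
  have "\<exists>y. packing V E c y \<and> k \<le> sum y E" if "\<And>B. cover V E B \<Longrightarrow> k \<le> sum c B" for c k
    by (rule packing_of_cover_bound[OF fin sub ne bounded that])
  then show "MFMC V E"
    unfolding MFMC_def packs_iff[OF fin sub ne] by simp
qed (simp add: MFMC_def)

end
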